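(* Consider the targeted advertising model described in the context. Suppose that $H^{-1}$ admits an $(s_n,r_{1n})$-sparse approximation, that the design is regular, that the optimal advertising intensities satisfy $0<p_O^\star<\bar p\cdot e_O$ (entrywise), and that $s_n\sqrt{\log(|V_O|)/n}+r_{1n}=o(1)$. Let $\check W^\mu$ be the thresholded estimator of $\tilde H^{-1}$ (defined in the context), with thresholds such that, for some constant $C_0>0$, with probability $1-o(1)$, $2|\check W_{kj}-(\tilde H^{-1})_{kj}|\le\mu_{kj}\le C_0\sqrt{\log|V_O|/n}$ for all $k,j\in V_O$. Define $$\hat p_O=\Big(\big[-\tfrac1\chi(\check W^\mu)^Te_O\big]\wedge\bar p\cdot e_O\Big)_+ .$$ Then, for some constant $C_1>0$, with probability $1-o(1)$, $$R(\hat p_O)\le C_1\Big(s_n^2\,\frac{\log|V_O|}{n}+r_{1n}^2\Big),\qquad R(p_O):=\frac{\Pi(p_O^\star)-\Pi(p_O)}{\Pi(p_O^\star)} .$$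
   Context: **Asymptotics.** $n$ is the number of periods, $[n]=\{1,\dots,n\}$; limits are as $n\to\infty$. The network, its sizes, the agents' parameters, the data distribution, $s_n,r_{1n},M_\varepsilon,M_\Psi$ may depend on $n$. A "constant" is a number not depending on $n$ or on the network sizes; $\chi,\bar p,\bar a,\underline z,\bar z,\zeta$ are constants. **Advertising model.** $V=V_O\sqcup V_L$ is a finite set of agents (observable and latent), $G\in\mathbb R_{\ge0}^{V\times V}$ the weights, $M=I-G$. There is $\zeta>0$ with $1\ge\sum_jG_{ij}+\zeta$ and $1\ge\sum_jG_{ji}+\zeta$ for all $i\in V$. Consumption under advertising intensities $p$ is determined by $y_i=a_i+z_ip_i+\sum_jG_{ij}y_j+\xi_i$, where $0\le a_i<\bar a$, $0<\underline z\le z_i<\bar z$, $\xi_i$ are zero-mean shocks with $\mathbb P(a_i+\xi_i\ge0)=1$, and $p_i=0$ for $i\in V_L$. Subscripts $O,L$ denote sub-vectors/blocks for $V_O,V_L$; $e_O$ is the all-ones vector in $\mathbb R^{V_O}$. Put $S_{OL}=M_{OL}M_{LL}^{-1}$, $H=M_{OO}-M_{OL}M_{LL}^{-1}M_{LO}$, $Z_{OO}=\mathrm{diag}(z_i)_{i\in V_O}$, $\tilde H^{-1}:=-H^{-1}Z_{OO}$, $v_O=H^{-1}a_O-H^{-1}S_{OL}a_L$. In period $t\in[n]$ with intensities $p_O^{(t)}$ (with $|p^{(t)}_i|\le\bar p$) and shocks $\xi^{(t)}$ independent over $t$, consumptions satisfy $$y_O^{(t)}=v_O-\tilde H^{-1}p_O^{(t)}+\varepsilon_O^{(t)},\quad\varepsilon_O^{(t)}=H^{-1}\xi_O^{(t)}-H^{-1}S_{OL}\xi_L^{(t)}.\qquad(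 * )$$ The advertiser observes only $\{(p_O^{(t)},y_O^{(t)})\}_{t\in[n]}$. With advertising cost parameter $\chi>0$, her expected payoff is $\Pi(p_O)=e_O^T(v_O-\tilde H^{-1}p_O)-\frac\chi2\sum_{i\in V_O}p_i^2$, and $p_O^\star$ is the maximizer of $\Pi$ over $0\le p_O\le\bar p\cdot e_O$. For a vector $x$, $[(x\wedge\bar p\cdot e_O)_+]_i=\min\{\bar p,\max\{x_i,0\}\}$. **Norms and indices.** $\|A\|_1,\|A\|_\infty$ are the maximum absolute column and row sums; $A_{k,\cdot}$ and $A_{\cdot,k}$ the $k$th row and column. $\bar V_O=\{0\}\cup V_O$; $(1;p_O^{(t)})\in\mathbb R^{\bar V_O}$ has $0$th entry $1$ and $j$th entry $p_j^{(t)}$. $\mathbf 1_{kj}=1$ if $k=j$, else $0$. $\Phi$ is the standard normal CDF. **Sparse approximation.** A matrix is $s$-sparse if each row and each column has at most $s$ nonzero entries. $H^{-1}$ admits an $(s,r_1)$-sparse approximation if there is an $s$-sparse $\bar W$ with $\max\{\|H^{-1}-\bar W\|_1,\|H^{-1}-\bar W\|_\infty\}\le r_1$. **Regular design.** The design is regular if, for constants $0<c<C$, $C'>0$ and parameters $M_\varepsilon,M_\Psi\ge1$: 1. the data $(p_O^{(t)},y_O^{(t)})$, $t\in[n]$, are i.i.d. and satisfy $( * )$, and $E[\varepsilon_O^{(t)}\mid p_O^{(t)}]=0$; 2. for all $t$: $\min_{j\in V_O}E[(\varepsilon_j^{(t)})^2\mid p_O^{(t)}]\ge c$, $\max_{j\in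 V_O}E[|\varepsilon_j^{(t)}|^4\mid p_O^{(t)}]\le C$, and $E[\max_{t\in[n],j\in V_O}|\varepsilon_j^{(t)}|^4\mid\{p_O^{(t)}\}]\le M_\varepsilon$; 3. $\bar\Psi:=E[(1;p_O^{(t)})(1;p_O^{(t)})^T]^{-1}$ satisfies $\min_{k,j\in\bar V_O}E[\{\bar\Psi_{k,\cdot}(1;p_O^{(t)})(1;p_O^{(t)})_j-\mathbf 1_{kj}\}^2]\ge c$, $\max_{k,j\in\bar V_O}E[|\bar\Psi_{k,\cdot}(1;p_O^{(t)})(1;p_O^{(t)})_j|^4]\le C$, $E[\max_{t\in[n];j,k\in\bar V_O}|\bar\Psi_{k,\cdot}(1;p_O^{(t)})(1;p_O^{(t)})_j|^4]\le M_\Psi$, and the eigenvalues of $\bar\Psi$ are bounded above by a constant; 4. $s_n^2(\log|V_O|)(\log n)^3=o(n)$, $M_\varepsilon M_\Psi\log|V_O|=o(n)$, $C'\log|V_O|\ge\log n$. **Estimators.** Put $M_n^2=1\vee\max_{k\in V_O}\frac1n\sum_t(p_k^{(t)})^4$, $\tau=\frac1{4M_n}$, $\lambda=\frac1{\sqrt n}\Phi^{-1}\big(1-\frac1{3n|V_O|^2}\big)$, $\hat\Sigma=\frac1n\sum_t(1;p_O^{(t)})(1;p_O^{(t)})^T$. Step 1: $(\hat W,\hat v,\hat z)$ minimizes $\sum_{k\in V_O}\big(\|(\tilde v_k,\tilde W_{k,\cdot})\|_1+\tau z_k\big)$ over $(\tilde W,\tilde v,z)$ subject to, for all $k\in V_O$,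 $j\in\bar V_O$: $\big|\frac1n\sum_t\{y_k^{(t)}-(\tilde v_k-\tilde W_{k,\cdot}p_O^{(t)})\}(1;p_O^{(t)})_j\big|\le\lambda z_k$ and $\big\{\frac1n\sum_t\{y_k^{(t)}-(\tilde v_k-\tilde W_{k,\cdot}p_O^{(t)})\}^2(1;p_O^{(t)})_j^2\big\}^{1/2}\le z_k$. Step 2: $\hat\Psi\in\mathbb R^{\bar V_O\times\bar V_O}$ is the $\Psi$-part of a minimizer of $\sum_{k\in\bar V_O}\big\{\big(\frac1n\sum_t|\Psi_{k,\cdot}(1;p_O^{(t)})|^4\big)^{1/4}+z_k\big\}$ over $(z,\Psi)$ subject to, for all $k,j\in\bar V_O$: $|\Psi_{k,\cdot}\hat\Sigma_{\cdot,j}-\mathbf 1_{kj}|\le\lambda z_k$ and $\big\{\frac1n\sum_t\{\Psi_{k,\cdot}(1;p_O^{(t)})(1;p_O^{(t)})_j-\mathbf 1_{kj}\}^2\big\}^{1/2}\le z_k$. Step 3 (debiased estimator): $(-\check v^T;\check W^T)=(-\hat v^T;\hat W^T)-\hat\Psi\big\{\frac1n\sum_t(1;p_O^{(t)})\{y_O^{(t)}-(\hat v-\hat Wp_O^{(t)})\}^T\big\}$. Step 4 (thresholded estimator, for thresholds $\mu_{kj}$): $\check W^\mu_{kj}=\check W_{kj}\,1\{|\check W_{kj}|>\mu_{kj}\}$, $k,j\in V_O$. *)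

theory Defs
  imports "HOL-Probability.Probability" "HOL-Library.Landau_Symbols"
begin

text \<open>The network size varies with \<open>n\<close>, so matrices are functions \<open>'i \<Rightarrow> 'i \<Rightarrow> real\<close> of which only
  the entries indexed by an explicit finite set matter.\<close>

definition is_minv :: "'i set \<Rightarrow> ('i \<Rightarrow> 'i \<Rightarrow> real) \<Rightarrow> ('i \<Rightarrow> 'i \<Rightarrow> real) \<Rightarrow> bool" where
  "is_minv I A B \<longleftrightarrow> (\<forall>i\<in>I. \<forall>j\<in>I.
     (\<Sum>k\<in>I. A i k * B k j) = of_bool (i = j) \<and> (\<Sum>k\<in>I. B i k * A k j) = of_bool (i = j))"

definition minvertible :: "'i set \<Rightarrow> ('i \<Rightarrow> 'i \<Rightarrow> real) \<Rightarrow> bool" where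
  "minvertible I A \<longleftrightarrow> (\<exists>B. is_minv I A B)"

text \<open>On \<open>I \<times> I\<close> the inverse is unique if it exists, so \<open>SOME\<close> involves no real choice.\<close>

definition minv :: "'i set \<Rightarrow> ('i \<Rightarrow> 'i \<Rightarrow> real) \<Rightarrow> 'i \<Rightarrow> 'i \<Rightarrow> real" where
  "minv I A = (let B = (SOME B. is_minv I A B) in (\<lambda>i j. if i \<in> I \<and> j \<in> I then B i j else 0))"

definition norm_col :: "'i set \<Rightarrow> ('i \<Rightarrow> 'i \<Rightarrow> real) \<Rightarrow> real" where
  "norm_col I A = Max ((\<lambda>j. \<Sum>i\<in>I. \<bar>A i j\<bar>) ` I)"

definition norm_row :: "'i set \<Rightarrow> ('i \<Rightarrow> 'i \<Rightarrow> real) \<Rightarrow> real" where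
  "norm_row I A = Max ((\<lambda>i. \<Sum>j\<in>I. \<bar>A i j\<bar>) ` I)"

definition sparse_mat :: "'i set \<Rightarrow> nat \<Rightarrow> ('i \<Rightarrow> 'i \<Rightarrow> real) \<Rightarrow> bool" where
  "sparse_mat I s A \<longleftrightarrow>
     (\<forall>i\<in>I. card {j\<in>I. A i j \<noteq> 0} \<le> s) \<and> (\<forall>j\<in>I. card {i\<in>I. A i j \<noteq> 0} \<le> s)"

definition sparse_approx :: "'i set \<Rightarrow> ('i \<Rightarrow> 'i \<Rightarrow> real) \<Rightarrow> nat \<Rightarrow> real \<Rightarrow> bool" where
  "sparse_approx I A s r \<longleftrightarrow> (\<exists>W. sparse_mat I s W \<and>
     max (norm_col I (\<lambda>i j. A i j - W i j)) (norm_row I (\<lambda>i j. A i j - W i j)) \<le> r)"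

definition is_eigenvalue :: "'i set \<Rightarrow> ('i \<Rightarrow> 'i \<Rightarrow> real) \<Rightarrow> real \<Rightarrow> bool" where
  "is_eigenvalue I A l \<longleftrightarrow>
     (\<exists>x. (\<exists>i\<in>I. x i \<noteq> 0) \<and> (\<forall>i\<in>I. (\<Sum>j\<in>I. A i j * x j) = l * x i))"

text \<open>Phrased through inner measure, so that no measurability of the estimators or thresholds is
  presupposed; for measurable events it is exactly convergence of the probabilities to 1.\<close>

definition whp :: "(nat \<Rightarrow> 'w measure) \<Rightarrow> (nat \<Rightarrow> 'w \<Rightarrow> bool) \<Rightarrow> bool" where
  "whp M P \<longleftrightarrow> (\<exists>A. (\<forall>n. A n \<in> sets (M n) \<and> (\<forall>\<omega>\<in>A n. P n \<omega>)) \<and>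
     (\<lambda>n. measure (M n) (A n)) \<longlonglongrightarrow> 1)"

text \<open>One instance of the model; a sequence of instances, indexed by the number of periods \<open>n\<close>, is
  considered below. The last three fields take the period as first argument.\<close>

record ('v, 'w) ad_model =
  obs :: "'v set"
  lat :: "'v set"
  weight :: "'v \<Rightarrow> 'v \<Rightarrow> real"
  base :: "'v \<Rightarrow> real"
  eff :: "'v \<Rightarrow> real"
  Pr :: "'w measure"
  shock :: "nat \<Rightarrow> 'v \<Rightarrow> 'w \<Rightarrow> real"
  intensity :: "nat \<Rightarrow> 'v \<Rightarrow> 'w \<Rightarrow> real"
  consumption :: "nat \<Rightarrow> 'v \<Rightarrow> 'w \<Rightarrow> real"

definition agents :: "('v, 'w) ad_model \<Rightarrow> 'v set" where
  "agents D = obs D \<union> lat D"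

definition Mmat :: "('v, 'w) ad_model \<Rightarrow> 'v \<Rightarrow> 'v \<Rightarrow> real" where
  "Mmat D i j = of_bool (i = j) - weight D i j"

definition S_OL :: "('v, 'w) ad_model \<Rightarrow> 'v \<Rightarrow> 'v \<Rightarrow> real" where
  "S_OL D i l = (\<Sum>k\<in>lat D. Mmat D i k * minv (lat D) (Mmat D) k l)"

definition Hmat :: "('v, 'w) ad_model \<Rightarrow> 'v \<Rightarrow> 'v \<Rightarrow> real" where
  "Hmat D i j = Mmat D i j - (\<Sum>l\<in>lat D. S_OL D i l * Mmat D l j)"

definition Hinv :: "('v, 'w) ad_model \<Rightarrow> 'v \<Rightarrow> 'v \<Rightarrow> real" where
  "Hinv D = minv (obs D) (Hmat D)"

definition Htinv :: "('v, 'w) ad_model \<Rightarrow> 'v \<Rightarrow> 'v \<Rightarrow> real" where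
  "Htinv D i j = - Hinv D i j * eff D j"

text \<open>\<open>H\<^sup>-\<^sup>1 x\<^sub>O - H\<^sup>-\<^sup>1 S\<^sub>O\<^sub>L x\<^sub>L\<close>, the map producing both the intercept and the noise.\<close>

definition reduce :: "('v, 'w) ad_model \<Rightarrow> ('v \<Rightarrow> real) \<Rightarrow> 'v \<Rightarrow> real" where
  "reduce D x i = (\<Sum>j\<in>obs D. Hinv D i j * x j)
     - (\<Sum>j\<in>obs D. Hinv D i j * (\<Sum>l\<in>lat D. S_OL D j l * x l))"

definition vO :: "('v, 'w) ad_model \<Rightarrow> 'v \<Rightarrow> real" where
  "vO D = reduce D (base D)"

definition noise :: "('v, 'w) ad_model \<Rightarrow> nat \<Rightarrow> 'v \<Rightarrow> 'w \<Rightarrow> real" where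
  "noise D t i \<omega> = reduce D (\<lambda>j. shock D t j \<omega>) i"

definition advertising_model ::
  "real \<Rightarrow> real \<Rightarrow> real \<Rightarrow> real \<Rightarrow> real \<Rightarrow> nat \<Rightarrow> ('v, 'w) ad_model \<Rightarrow> bool" where
  "advertising_model \<zeta> abar zlo zhi pbar n D \<longleftrightarrow>
     finite (agents D) \<and> obs D \<inter> lat D = {} \<and>
     (\<forall>i\<in>agents D. \<forall>j\<in>agents D. 0 \<le> weight D i j) \<and>
     (\<forall>i\<in>agents D. (\<Sum>j\<in>agents D. weight D i j) + \<zeta> \<le> 1) \<and>
     (\<forall>i\<in>agents D. (\<Sum>j\<in>agents D. weight D j i) + \<zeta> \<le> 1) \<and>
     (\<forall>i\<in>agents D. 0 \<le> base D i \<and> base D i < abar) \<and>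
     (\<forall>i\<in>agents D. zlo \<le> eff D i \<and> eff D i < zhi) \<and>
     prob_space (Pr D) \<and>
     (\<forall>t\<in>{1..n}. \<forall>i\<in>agents D.
        shock D t i \<in> borel_measurable (Pr D) \<and>
        intensity D t i \<in> borel_measurable (Pr D) \<and>
        consumption D t i \<in> borel_measurable (Pr D)) \<and>
     (\<forall>t\<in>{1..n}. \<forall>i\<in>agents D.
        integrable (Pr D) (shock D t i) \<and> integral\<^sup>L (Pr D) (shock D t i) = 0 \<and>
        (AE \<omega> in Pr D. 0 \<le> base D i + shock D t i \<omega>)) \<and>
     prob_space.indep_vars (Pr D) (\<lambda>_. PiM (agents D) (\<lambda>_. borel))
       (\<lambda>t \<omega>. \<lambda>i\<in>agents D. shock D t i \<omega>) {1..n} \<and>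
     (\<forall>t\<in>{1..n}. \<forall>i\<in>obs D. AE \<omega> in Pr D. \<bar>intensity D t i \<omega>\<bar> \<le> pbar) \<and>
     (\<forall>t\<in>{1..n}. \<forall>i\<in>lat D. AE \<omega> in Pr D. intensity D t i \<omega> = 0) \<and>
     (\<forall>t\<in>{1..n}. \<forall>i\<in>agents D. AE \<omega> in Pr D.
        consumption D t i \<omega> = base D i + eff D i * intensity D t i \<omega>
          + (\<Sum>j\<in>agents D. weight D i j * consumption D t j \<omega>) + shock D t i \<omega>)"

definition payoff :: "real \<Rightarrow> ('v, 'w) ad_model \<Rightarrow> ('v \<Rightarrow> real) \<Rightarrow> real" where
  "payoff chi D p = (\<Sum>i\<in>obs D. vO D i - (\<Sum>j\<in>obs D. Htinv D i j * p j))
     - chi / 2 * (\<Sum>i\<in>obs D. (p i)\<^sup>2)"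

definition optimal_intensities ::
  "real \<Rightarrow> real \<Rightarrow> ('v, 'w) ad_model \<Rightarrow> ('v \<Rightarrow> real) \<Rightarrow> bool" where
  "optimal_intensities chi pbar D p \<longleftrightarrow>
     is_arg_max (payoff chi D) (\<lambda>q. \<forall>i\<in>obs D. 0 \<le> q i \<and> q i \<le> pbar) p"

definition regret ::
  "real \<Rightarrow> ('v, 'w) ad_model \<Rightarrow> ('v \<Rightarrow> real) \<Rightarrow> ('v \<Rightarrow> real) \<Rightarrow> real" where
  "regret chi D pstar p = (payoff chi D pstar - payoff chi D p) / payoff chi D pstar"

text \<open>The index set \<open>{0} \<union> V\<^sub>O\<close> is rendered in the option type, with \<open>None\<close> in the role of \<open>0\<close>.\<close>

definition obs0 :: "('v, 'w) ad_model \<Rightarrow> 'v option set" where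
  "obs0 D = insert None (Some ` obs D)"

definition regressor :: "('v, 'w) ad_model \<Rightarrow> nat \<Rightarrow> 'v option \<Rightarrow> 'w \<Rightarrow> real" where
  "regressor D t j \<omega> = (case j of None \<Rightarrow> 1 | Some i \<Rightarrow> intensity D t i \<omega>)"

text \<open>The data are identically distributed, so the second moments may be taken in period \<open>1\<close>.\<close>

definition second_moment :: "('v, 'w) ad_model \<Rightarrow> 'v option \<Rightarrow> 'v option \<Rightarrow> real" where
  "second_moment D j k = (\<integral>\<omega>. regressor D 1 j \<omega> * regressor D 1 k \<omega> \<partial>Pr D)"

definition Psi_bar :: "('v, 'w) ad_model \<Rightarrow> 'v option \<Rightarrow> 'v option \<Rightarrow> real" where
  "Psi_bar D = minv (obs0 D) (second_moment D)"

definition psi_score ::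
  "('v, 'w) ad_model \<Rightarrow> nat \<Rightarrow> 'v option \<Rightarrow> 'v option \<Rightarrow> 'w \<Rightarrow> real" where
  "psi_score D t k j \<omega> =
     (\<Sum>l\<in>obs0 D. Psi_bar D k l * regressor D t l \<omega>) * regressor D t j \<omega>"

definition sigma_period :: "('v, 'w) ad_model \<Rightarrow> nat \<Rightarrow> 'w measure" where
  "sigma_period D t = vimage_algebra (space (Pr D)) (\<lambda>\<omega>. \<lambda>i\<in>obs D. intensity D t i \<omega>)
     (PiM (obs D) (\<lambda>_. borel))"

definition sigma_all :: "nat \<Rightarrow> ('v, 'w) ad_model \<Rightarrow> 'w measure" where
  "sigma_all n D = vimage_algebra (space (Pr D))
     (\<lambda>\<omega>. \<lambda>(t, i)\<in>{1..n} \<times> obs D. intensity D t i \<omega>) (PiM ({1..n} \<times> obs D) (\<lambda>_. borel))"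

abbreviation data_space :: "('v, 'w) ad_model \<Rightarrow> (('v \<Rightarrow> real) \<times> ('v \<Rightarrow> real)) measure" where
  "data_space D \<equiv> PiM (obs D) (\<lambda>_. borel) \<Otimes>\<^sub>M PiM (obs D) (\<lambda>_. borel)"

definition data_point ::
  "('v, 'w) ad_model \<Rightarrow> nat \<Rightarrow> 'w \<Rightarrow> ('v \<Rightarrow> real) \<times> ('v \<Rightarrow> real)" where
  "data_point D t \<omega> = (\<lambda>i\<in>obs D. intensity D t i \<omega>, \<lambda>i\<in>obs D. consumption D t i \<omega>)"

definition regular_sampling :: "nat \<Rightarrow> ('v, 'w) ad_model \<Rightarrow> bool" where
  "regular_sampling n D \<longleftrightarrow>
     prob_space.indep_vars (Pr D) (\<lambda>_. data_space D) (data_point D) {1..n} \<and>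
     (\<forall>t\<in>{1..n}. distr (Pr D) (data_space D) (data_point D t)
        = distr (Pr D) (data_space D) (data_point D 1)) \<and>
     (\<forall>t\<in>{1..n}. \<forall>i\<in>obs D. AE \<omega> in Pr D.
        consumption D t i \<omega>
          = vO D i - (\<Sum>j\<in>obs D. Htinv D i j * intensity D t j \<omega>) + noise D t i \<omega>) \<and>
     (\<forall>t\<in>{1..n}. \<forall>i\<in>obs D. AE \<omega> in Pr D.
        real_cond_exp (Pr D) (sigma_period D t) (noise D t i) \<omega> = 0)"

text \<open>Moment bounds use the \<open>ennreal\<close>-valued (conditional) expectation, since the real-valued one
  returns \<open>0\<close> where the moment is infinite.\<close>

definition regular_noise ::
  "real \<Rightarrow> real \<Rightarrow> real \<Rightarrow> nat \<Rightarrow> ('v, 'w) ad_model \<Rightarrow> bool" where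
  "regular_noise c C Me n D \<longleftrightarrow>
     (\<forall>t\<in>{1..n}. \<forall>j\<in>obs D. AE \<omega> in Pr D.
        ennreal c \<le> nn_cond_exp (Pr D) (sigma_period D t) (\<lambda>x. ennreal ((noise D t j x)\<^sup>2)) \<omega> \<and>
        nn_cond_exp (Pr D) (sigma_period D t) (\<lambda>x. ennreal (\<bar>noise D t j x\<bar> ^ 4)) \<omega> \<le> ennreal C) \<and>
     (AE \<omega> in Pr D. nn_cond_exp (Pr D) (sigma_all n D)
        (\<lambda>x. ennreal (Max ((\<lambda>(t, j). \<bar>noise D t j x\<bar> ^ 4) ` ({1..n} \<times> obs D)))) \<omega> \<le> ennreal Me)"

definition regular_regressors ::
  "real \<Rightarrow> real \<Rightarrow> real \<Rightarrow> real \<Rightarrow> nat \<Rightarrow> ('v, 'w) ad_model \<Rightarrow> bool" where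
  "regular_regressors c C Ce MP n D \<longleftrightarrow>
     minvertible (obs0 D) (second_moment D) \<and>
     (\<forall>t\<in>{1..n}. \<forall>k\<in>obs0 D. \<forall>j\<in>obs0 D.
        ennreal c \<le> (\<integral>\<^sup>+\<omega>. ennreal ((psi_score D t k j \<omega> - of_bool (k = j))\<^sup>2) \<partial>Pr D) \<and>
        (\<integral>\<^sup>+\<omega>. ennreal (\<bar>psi_score D t k j \<omega>\<bar> ^ 4) \<partial>Pr D) \<le> ennreal C) \<and>
     (\<integral>\<^sup>+\<omega>. ennreal (Max ((\<lambda>(t, k, j). \<bar>psi_score D t k j \<omega>\<bar> ^ 4)
        ` ({1..n} \<times> obs0 D \<times> obs0 D))) \<partial>Pr D) \<le> ennreal MP \<and>
     (\<forall>l. is_eigenvalue (obs0 D) (Psi_bar D) l \<longrightarrow> l \<le> Ce)"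

definition regular_design :: "(nat \<Rightarrow> nat) \<Rightarrow> (nat \<Rightarrow> ('v, 'w) ad_model) \<Rightarrow> bool" where
  "regular_design s D \<longleftrightarrow> (\<exists>c C C' Ce :: real. \<exists>Me MP :: nat \<Rightarrow> real.
     0 < c \<and> c < C \<and> 0 < C' \<and>
     (\<forall>n\<ge>1. 1 \<le> Me n \<and> 1 \<le> MP n \<and>
        regular_sampling n (D n) \<and>
        regular_noise c C (Me n) n (D n) \<and>
        regular_regressors c C Ce (MP n) n (D n) \<and>
        ln (real n) \<le> C' * ln (real (card (obs (D n))))) \<and>
     (\<lambda>n. (real (s n))\<^sup>2 * ln (real (card (obs (D n)))) * (ln (real n)) ^ 3) \<in> o(\<lambda>n. real n) \<and>
     (\<lambda>n. Me n * MP n * ln (real (card (obs (D n))))) \<in> o(\<lambda>n. real n))"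

definition tau :: "nat \<Rightarrow> ('v, 'w) ad_model \<Rightarrow> 'w \<Rightarrow> real" where
  "tau n D \<omega> = 1 / (4 * sqrt (max 1
     (Max ((\<lambda>k. (\<Sum>t=1..n. (intensity D t k \<omega>) ^ 4) / real n) ` obs D))))"

text \<open>The normal distribution function is strictly increasing with range \<open>{0<..<1}\<close>, so \<open>inv\<close> is the
  quantile function there.\<close>

definition lam :: "nat \<Rightarrow> ('v, 'w) ad_model \<Rightarrow> real" where
  "lam n D = inv (cdf std_normal_distribution) (1 - 1 / (3 * real n * (real (card (obs D)))\<^sup>2))
     / sqrt (real n)"

definition resid :: "('v, 'w) ad_model \<Rightarrow> ('v \<Rightarrow> 'v \<Rightarrow> real) \<Rightarrow> ('v \<Rightarrow> real) \<Rightarrow>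
    nat \<Rightarrow> 'v \<Rightarrow> 'w \<Rightarrow> real" where
  "resid D W v t k \<omega> =
     consumption D t k \<omega> - (v k - (\<Sum>i\<in>obs D. W k i * intensity D t i \<omega>))"

definition step1_feasible :: "nat \<Rightarrow> ('v, 'w) ad_model \<Rightarrow> 'w \<Rightarrow>
    ('v \<Rightarrow> 'v \<Rightarrow> real) \<times> ('v \<Rightarrow> real) \<times> ('v \<Rightarrow> real) \<Rightarrow> bool" where
  "step1_feasible n D \<omega> = (\<lambda>(W, v, z). \<forall>k\<in>obs D. \<forall>j\<in>obs0 D.
     \<bar>(\<Sum>t=1..n. resid D W v t k \<omega> * regressor D t j \<omega>) / real n\<bar> \<le> lam n D * z k \<and>
     sqrt ((\<Sum>t=1..n. (resid D W v t k \<omega>)\<^sup>2 * (regressor D t j \<omega>)\<^sup>2) / real n) \<le> z k)"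

definition step1_objective :: "nat \<Rightarrow> ('v, 'w) ad_model \<Rightarrow> 'w \<Rightarrow>
    ('v \<Rightarrow> 'v \<Rightarrow> real) \<times> ('v \<Rightarrow> real) \<times> ('v \<Rightarrow> real) \<Rightarrow> real" where
  "step1_objective n D \<omega> = (\<lambda>(W, v, z).
     \<Sum>k\<in>obs D. (\<bar>v k\<bar> + (\<Sum>i\<in>obs D. \<bar>W k i\<bar>)) + tau n D \<omega> * z k)"

definition step1_solution :: "nat \<Rightarrow> ('v, 'w) ad_model \<Rightarrow> 'w \<Rightarrow>
    ('v \<Rightarrow> 'v \<Rightarrow> real) \<Rightarrow> ('v \<Rightarrow> real) \<Rightarrow> ('v \<Rightarrow> real) \<Rightarrow> bool" where
  "step1_solution n D \<omega> W v z \<longleftrightarrow>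
     is_arg_min (step1_objective n D \<omega>) (step1_feasible n D \<omega>) (W, v, z)"

definition Sigma_hat :: "nat \<Rightarrow> ('v, 'w) ad_model \<Rightarrow> 'w \<Rightarrow> 'v option \<Rightarrow> 'v option \<Rightarrow> real" where
  "Sigma_hat n D \<omega> j k = (\<Sum>t=1..n. regressor D t j \<omega> * regressor D t k \<omega>) / real n"

definition step2_feasible :: "nat \<Rightarrow> ('v, 'w) ad_model \<Rightarrow> 'w \<Rightarrow>
    ('v option \<Rightarrow> real) \<times> ('v option \<Rightarrow> 'v option \<Rightarrow> real) \<Rightarrow> bool" where
  "step2_feasible n D \<omega> = (\<lambda>(z, \<Psi>). \<forall>k\<in>obs0 D. \<forall>j\<in>obs0 D.
     \<bar>(\<Sum>l\<in>obs0 D. \<Psi> k l * Sigma_hat n D \<omega> l j) - of_bool (k = j)\<bar> \<le> lam n D * z k \<and>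
     sqrt ((\<Sum>t=1..n. ((\<Sum>l\<in>obs0 D. \<Psi> k l * regressor D t l \<omega>) * regressor D t j \<omega>
        - of_bool (k = j))\<^sup>2) / real n) \<le> z k)"

definition step2_objective :: "nat \<Rightarrow> ('v, 'w) ad_model \<Rightarrow> 'w \<Rightarrow>
    ('v option \<Rightarrow> real) \<times> ('v option \<Rightarrow> 'v option \<Rightarrow> real) \<Rightarrow> real" where
  "step2_objective n D \<omega> = (\<lambda>(z, \<Psi>). \<Sum>k\<in>obs0 D.
     root 4 ((\<Sum>t=1..n. \<bar>\<Sum>l\<in>obs0 D. \<Psi> k l * regressor D t l \<omega>\<bar> ^ 4) / real n) + z k)"

definition step2_solution :: "nat \<Rightarrow> ('v, 'w) ad_model \<Rightarrow> 'w \<Rightarrow>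
    ('v option \<Rightarrow> 'v option \<Rightarrow> real) \<Rightarrow> bool" where
  "step2_solution n D \<omega> \<Psi> \<longleftrightarrow>
     (\<exists>z. is_arg_min (step2_objective n D \<omega>) (step2_feasible n D \<omega>) (z, \<Psi>))"

text \<open>The stacked matrix with rows indexed by \<open>{0} \<union> V\<^sub>O\<close>: row \<open>None\<close> is \<open>- v\<^sup>T\<close>, the other rows form
  the transpose of \<open>W\<close>.\<close>

definition stacked :: "('v \<Rightarrow> 'v \<Rightarrow> real) \<Rightarrow> ('v \<Rightarrow> real) \<Rightarrow> 'v option \<Rightarrow> 'v \<Rightarrow> real" where
  "stacked W v j k = (case j of None \<Rightarrow> - v k | Some i \<Rightarrow> W k i)"

definition debiased_stacked :: "nat \<Rightarrow> ('v, 'w) ad_model \<Rightarrow> 'w \<Rightarrow> ('v \<Rightarrow> 'v \<Rightarrow> real) \<Rightarrow>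
    ('v \<Rightarrow> real) \<Rightarrow> ('v option \<Rightarrow> 'v option \<Rightarrow> real) \<Rightarrow> 'v option \<Rightarrow> 'v \<Rightarrow> real" where
  "debiased_stacked n D \<omega> W v \<Psi> j k = stacked W v j k
     - (\<Sum>l\<in>obs0 D. \<Psi> j l * ((\<Sum>t=1..n. regressor D t l \<omega> * resid D W v t k \<omega>) / real n))"

definition W_check :: "nat \<Rightarrow> ('v, 'w) ad_model \<Rightarrow> 'w \<Rightarrow> ('v \<Rightarrow> 'v \<Rightarrow> real) \<Rightarrow>
    ('v \<Rightarrow> real) \<Rightarrow> ('v option \<Rightarrow> 'v option \<Rightarrow> real) \<Rightarrow> 'v \<Rightarrow> 'v \<Rightarrow> real" where
  "W_check n D \<omega> W v \<Psi> k j = debiased_stacked n D \<omega> W v \<Psi> (Some j) k"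

definition threshold :: "('v \<Rightarrow> 'v \<Rightarrow> real) \<Rightarrow> ('v \<Rightarrow> 'v \<Rightarrow> real) \<Rightarrow> 'v \<Rightarrow> 'v \<Rightarrow> real" where
  "threshold \<mu> W k j = W k j * of_bool (\<bar>W k j\<bar> > \<mu> k j)"

definition p_hat :: "real \<Rightarrow> real \<Rightarrow> ('v, 'w) ad_model \<Rightarrow> ('v \<Rightarrow> 'v \<Rightarrow> real) \<Rightarrow> 'v \<Rightarrow> real" where
  "p_hat chi pbar D W i = min pbar (max (- (1 / chi) * (\<Sum>k\<in>obs D. W k i)) 0)"

end

(* The payoff is a separable concave quadratic, so an interior optimum is the unconstrained one,
   q = -(1/chi) (H~^-1)^T e_O, and the payoff loss of p is chi/2 |p - q|^2. Replacing
   the column sums of H~^-1 by those of the thresholded estimator therefore costs at most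
   |V_O|/(2 chi) times the squared 1-norm of the estimation error, and thresholding bounds that norm
   by O(s sqrt(log|V_O|/n) + r_1): each entry of the error is O(sqrt(log|V_O|/n)) and also at most
   the corresponding entry of H~^-1; use the first bound on the support of the sparse approximation
   and the second off it. Conversely H^-1 is the observable block of the Neumann series
   (I - G)^-1, which is entrywise nonnegative with diagonal at least 1; hence v_O is nonnegative,
   q is at least zlo/chi, and the optimal payoff is at least of order |V_O|. *)
theory Submission
  imports Defs
begin

section \<open>Inverses of M-matrices\<close>

fun mpow :: "'i set \<Rightarrow> ('i \<Rightarrow> 'i \<Rightarrow> real) \<Rightarrow> nat \<Rightarrow> 'i \<Rightarrow> 'i \<Rightarrow> real" where
  "mpow I A 0 i j = of_bool (i = j)"
| "mpow I A (Suc n) i j = (\<Sum>k\<in>I. mpow I A n i k * A k j)"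

text \<open>\<open>mpow\<close> multiplies on the right; associativity moves the new factor to the
  left. Both forms are needed because \<open>is_minv\<close> asks for a two-sided inverse.\<close>

lemma mpow_Suc_left:
  assumes "finite I" "i \<in> I" "j \<in> I"
  shows "mpow I A (Suc n) i j = (\<Sum>k\<in>I. A i k * mpow I A n k j)"
  using assms(3)
proof (induction n arbitrary: j)
  case 0
  then show ?case using assms by (simp add: of_bool_def sum.delta if_distrib if_distribR cong: if_cong)
next
  case (Suc n)
  have "mpow I A (Suc (Suc n)) i j = (\<Sum>k\<in>I. (\<Sum>l\<in>I. A i l * mpow I A n l k) * A k j)"
    unfolding mpow.simps(2)[of I A "Suc n"] using Suc.IH by (intro sum.cong) auto
  also have "\<dots> = (\<Sum>l\<in>I. \<Sum>k\<in>I. A i l * mpow I A n l k * A k j)"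
    by (subst sum.swap) (simp add: sum_distrib_right)
  finally show ?case by (simp add: sum_distrib_left mult.assoc)
qed

lemma mpow_nonneg:
  assumes "\<And>i j. i \<in> I \<Longrightarrow> j \<in> I \<Longrightarrow> 0 \<le> A i j" "i \<in> I" "j \<in> I"
  shows "0 \<le> mpow I A n i j"
  using assms(3) by (induction n arbitrary: j) (auto intro!: sum_nonneg mult_nonneg_nonneg assms)

text \<open>A row sum of \<open>A^(n+1)\<close> combines the row sums of \<open>A\<close> with the
  entries of \<open>A^n\<close> as nonnegative weights, so each step costs a factor
  \<open>r\<close>.\<close>

lemma mpow_row_sum_le:
  assumes "finite I" and nonneg: "\<And>i j. i \<in> I \<Longrightarrow> j \<in> I \<Longrightarrow> 0 \<le> A i j"
    and row: "\<And>i. i \<in> I \<Longrightarrow> (\<Sum>j\<in>I. A i j) \<le> r" and "0 \<le> r" and "i \<in> I"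
  shows "(\<Sum>j\<in>I. mpow I A n i j) \<le> r ^ n"
proof (induction n)
  case 0
  then show ?case using assms(1,5) by (simp add: of_bool_def)
next
  case (Suc n)
  have "(\<Sum>j\<in>I. mpow I A (Suc n) i j) = (\<Sum>k\<in>I. mpow I A n i k * (\<Sum>j\<in>I. A k j))"
    by (simp add: sum_distrib_left) (rule sum.swap)
  also have "\<dots> \<le> (\<Sum>k\<in>I. mpow I A n i k * r)"
    by (intro sum_mono mult_left_mono row mpow_nonneg nonneg \<open>i \<in> I\<close>)
  also have "\<dots> = (\<Sum>k\<in>I. mpow I A n i k) * r" by (simp add: sum_distrib_right)
  also have "\<dots> \<le> r ^ n * r" using Suc \<open>0 \<le> r\<close> by (rule mult_right_mono)
  finally show ?case by (simp add: mult.commute)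
qed

text \<open>The inverse of the identity minus \<open>A\<close> is the Neumann series
  \<open>B\<close>, the sum of all powers of \<open>A\<close>, whose entries are dominated by a
  geometric series. Multiplication by \<open>A\<close> on either side drops the zeroth term, so
  \<open>A B\<close> and \<open>B A\<close> both equal \<open>B\<close> minus the identity. As
  \<open>B A\<close> is nonnegative, \<open>B\<close> dominates the identity entrywise.\<close>

lemma neumann_inverse:
  assumes fin: "finite I" and nonneg: "\<And>i j. i \<in> I \<Longrightarrow> j \<in> I \<Longrightarrow> 0 \<le> A i j"
    and row: "\<And>i. i \<in> I \<Longrightarrow> (\<Sum>j\<in>I. A i j) \<le> r" and "r < 1"
  obtains B where "is_minv I (\<lambda>i j. of_bool (i = j) - A i j) B"
    "\<And>i j. i \<in> I \<Longrightarrow> j \<in> I \<Longrightarrow> of_bool (i = j) \<le> B i j"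
proof -
  define B where "B i j = (\<Sum>n. mpow I A n i j)" for i j
  \<comment> \<open>A negative \<open>r\<close> can occur only for empty \<open>I\<close>;
    \<open>max 0 r\<close> is a ratio in \<open>[0, 1)\<close> that serves in every case.\<close>
  have row': "(\<Sum>j\<in>I. A i j) \<le> max 0 r" if "i \<in> I" for i
    using row[OF that] by simp
  have summable: "summable (\<lambda>n. mpow I A n i j)" if "i \<in> I" "j \<in> I" for i j
  proof (rule summable_comparison_test'[of "\<lambda>n. max 0 r ^ n" 0])
    fix n :: nat
    have "mpow I A n i j \<le> (\<Sum>j\<in>I. mpow I A n i j)"
      using that fin by (intro member_le_sum mpow_nonneg nonneg) auto
    also have "\<dots> \<le> max 0 r ^ n"
      by (rule mpow_row_sum_le[OF fin nonneg row' _ that(1)]) auto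
    finally show "norm (mpow I A n i j) \<le> max 0 r ^ n"
      using mpow_nonneg[of I A i j n] nonneg that by simp
  qed (use \<open>r < 1\<close> in \<open>simp add: summable_geometric\<close>)
  have tail: "(\<Sum>n. mpow I A (Suc n) i j) = B i j - of_bool (i = j)" if "i \<in> I" "j \<in> I" for i j
    using suminf_split_head[OF summable[OF that]] unfolding B_def by simp
  have right: "(\<Sum>k\<in>I. B i k * A k j) = B i j - of_bool (i = j)" if "i \<in> I" "j \<in> I" for i j
  proof -
    have "(\<Sum>k\<in>I. B i k * A k j) = (\<Sum>k\<in>I. \<Sum>n. mpow I A n i k * A k j)"
      unfolding B_def using summable that by (intro sum.cong refl suminf_mult2) auto
    also have "\<dots> = (\<Sum>n. \<Sum>k\<in>I. mpow I A n i k * A k j)"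
      using summable that by (intro suminf_sum[symmetric] summable_mult2) auto
    also have "\<dots> = (\<Sum>n. mpow I A (Suc n) i j)" by simp
    finally show ?thesis using tail[OF that] by simp
  qed
  have left: "(\<Sum>k\<in>I. A i k * B k j) = B i j - of_bool (i = j)" if "i \<in> I" "j \<in> I" for i j
  proof -
    have "(\<Sum>k\<in>I. A i k * B k j) = (\<Sum>k\<in>I. \<Sum>n. A i k * mpow I A n k j)"
      unfolding B_def using summable that by (intro sum.cong refl suminf_mult[symmetric]) auto
    also have "\<dots> = (\<Sum>n. \<Sum>k\<in>I. A i k * mpow I A n k j)"
      using summable that by (intro suminf_sum[symmetric] summable_mult) auto
    also have "\<dots> = (\<Sum>n. mpow I A (Suc n) i j)"
      using mpow_Suc_left[OF fin that] by (simp del: mpow.simps)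
    finally show ?thesis using tail[OF that] by simp
  qed
  have delta: "(\<Sum>k\<in>I. of_bool (i = k) * f k) = f i" "(\<Sum>k\<in>I. f k * of_bool (k = i)) = f i"
    if "i \<in> I" for i and f :: "'a \<Rightarrow> real"
    using that fin
    by (simp_all add: of_bool_def sum.delta if_distrib if_distribR cong: if_cong)
  show thesis
  proof
    show "is_minv I (\<lambda>i j. of_bool (i = j) - A i j) B"
      unfolding is_minv_def
      by (simp add: left_diff_distrib right_diff_distrib sum_subtractf left right delta)
  next
    fix i j assume ij: "i \<in> I" "j \<in> I"
    have "0 \<le> (\<Sum>k\<in>I. B i k * A k j)"
      unfolding B_def using ij nonneg
      by (intro sum_nonneg mult_nonneg_nonneg suminf_nonneg summable mpow_nonneg) auto
    then show "of_bool (i = j) \<le> B i j" using right[OF ij] by simp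
  qed
qed

text \<open>On \<open>I\<close>, \<open>B = B (A C) = (B A) C = C\<close>. This lets the chosen
  inverse \<open>minv\<close> be replaced by an explicit one.\<close>

lemma is_minv_unique:
  assumes fin: "finite I" and B: "is_minv I A B" and C: "is_minv I A C" and ij: "i \<in> I" "j \<in> I"
  shows "B i j = C i j"
proof -
  have "B i j = (\<Sum>k\<in>I. B i k * of_bool (k = j))"
    using fin ij by (simp add: of_bool_def if_distrib cong: if_cong)
  also have "\<dots> = (\<Sum>k\<in>I. B i k * (\<Sum>l\<in>I. A k l * C l j))"
    using C ij unfolding is_minv_def by (intro sum.cong) auto
  also have "\<dots> = (\<Sum>l\<in>I. (\<Sum>k\<in>I. B i k * A k l) * C l j)"
    unfolding sum_distrib_left sum_distrib_right by (subst sum.swap) (simp add: mult.assoc)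
  also have "\<dots> = (\<Sum>l\<in>I. of_bool (i = l) * C l j)"
    using B ij unfolding is_minv_def by (intro sum.cong) auto
  also have "\<dots> = C i j"
    using fin ij by (simp add: of_bool_def if_distribR if_distrib cong: if_cong)
  finally show ?thesis .
qed

lemma minv_is_minv:
  assumes "is_minv I A B"
  shows "is_minv I A (minv I A)"
proof -
  have "is_minv I A (SOME B. is_minv I A B)" using someI[of "is_minv I A" B, OF assms] .
  then show ?thesis unfolding is_minv_def minv_def Let_def by (simp cong: sum.cong)
qed

lemma minv_eq:
  assumes "finite I" "is_minv I A B" "i \<in> I" "j \<in> I"
  shows "minv I A i j = B i j"
  using is_minv_unique[OF assms(1) minv_is_minv[OF assms(2)] assms(2-4)] .

section \<open>The observable block of the Leontief inverse\<close>

text \<open>Block inversion with \<open>S = A_PQ A_QQ^-1\<close>: the block \<open>N_PP\<close> of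
  the full inverse inverts the Schur complement \<open>A_PP - S A_QP\<close>. Everything is read off
  block by block from \<open>A N\<close> and \<open>N A\<close> being the identity.\<close>

lemma schur_complement_inverse:
  fixes A :: "'i \<Rightarrow> 'i \<Rightarrow> real"
  assumes fin: "finite P" "finite Q" and disj: "P \<inter> Q = {}"
    and N: "is_minv (P \<union> Q) A N" and B: "is_minv Q A B"
    and S: "\<And>i l. S i l = (\<Sum>k\<in>Q. A i k * B k l)"
  shows "is_minv P (\<lambda>i j. A i j - (\<Sum>l\<in>Q. S i l * A l j)) N"
    and "\<And>i l. i \<in> P \<Longrightarrow> l \<in> Q \<Longrightarrow> (\<Sum>k\<in>P. N i k * S k l) = - N i l"
proof -
  have split: "(\<Sum>k\<in>P \<union> Q. f k) = (\<Sum>k\<in>P. f k) + (\<Sum>k\<in>Q. f k)" for f :: "'i \<Rightarrow> real"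
    using fin disj by (rule sum.union_disjoint)
  have AN: "(\<Sum>k\<in>P. A i k * N k j) + (\<Sum>k\<in>Q. A i k * N k j) = of_bool (i = j)"
    and NA: "(\<Sum>k\<in>P. N i k * A k j) + (\<Sum>k\<in>Q. N i k * A k j) = of_bool (i = j)"
    if "i \<in> P \<union> Q" "j \<in> P \<union> Q" for i j
    using N that unfolding is_minv_def split by blast+
  have delta: "(\<Sum>k\<in>Q. f k * of_bool (k = i)) = f i" if "i \<in> Q" for i and f :: "'i \<Rightarrow> real"
    using that fin by (simp add: of_bool_def if_distrib cong: if_cong)
  have SA: "(\<Sum>l\<in>Q. S i l * A l m) = A i m" if "m \<in> Q" for i m
  proof -
    have "(\<Sum>l\<in>Q. S i l * A l m) = (\<Sum>k\<in>Q. A i k * (\<Sum>l\<in>Q. B k l * A l m))"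
      unfolding S sum_distrib_left sum_distrib_right by (subst sum.swap) (simp add: mult.assoc)
    also have "\<dots> = (\<Sum>k\<in>Q. A i k * of_bool (k = m))"
      using B that unfolding is_minv_def by (intro sum.cong) auto
    finally show ?thesis using delta[OF that] by simp
  qed
  \<comment> \<open>The \<open>P\<close> by \<open>Q\<close> block of \<open>N A\<close> is zero,
    that is, \<open>N_PP A_PQ = - N_PQ A_QQ\<close>. Multiplying by \<open>B\<close> on the right
    cancels \<open>A_QQ\<close>.\<close>
  show NS: "(\<Sum>k\<in>P. N i k * S k l) = - N i l" if "i \<in> P" "l \<in> Q" for i l
  proof -
    have "(\<Sum>k\<in>P. N i k * S k l) = (\<Sum>m\<in>Q. (\<Sum>k\<in>P. N i k * A k m) * B m l)"
      unfolding S sum_distrib_left sum_distrib_right by (subst sum.swap) (simp add: mult.assoc)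
    also have "\<dots> = (\<Sum>m\<in>Q. - (\<Sum>k\<in>Q. N i k * A k m) * B m l)"
    proof (intro sum.cong refl)
      fix m assume "m \<in> Q"
      then have "i \<noteq> m" using that disj by blast
      with \<open>m \<in> Q\<close> have "(\<Sum>k\<in>P. N i k * A k m) = - (\<Sum>k\<in>Q. N i k * A k m)"
        using NA[of i m] that by auto
      then show "(\<Sum>k\<in>P. N i k * A k m) * B m l = - (\<Sum>k\<in>Q. N i k * A k m) * B m l" by simp
    qed
    also have "\<dots> = - (\<Sum>k\<in>Q. N i k * (\<Sum>m\<in>Q. A k m * B m l))"
      unfolding sum_distrib_left sum_distrib_right mult_minus_left sum_negf
      by (subst sum.swap) (simp add: mult.assoc)
    also have "\<dots> = - (\<Sum>k\<in>Q. N i k * of_bool (k = l))"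
      using B that unfolding is_minv_def by (intro arg_cong[where f = uminus] sum.cong) auto
    finally show ?thesis using delta[OF that(2)] by simp
  qed
  show "is_minv P (\<lambda>i j. A i j - (\<Sum>l\<in>Q. S i l * A l j)) N"
    unfolding is_minv_def
  proof (intro ballI conjI)
    fix i j assume ij: "i \<in> P" "j \<in> P"
    \<comment> \<open>The \<open>Q\<close> by \<open>P\<close> block of \<open>A N\<close> is zero,
      which turns \<open>A_QP N_PP\<close> into \<open>- A_QQ N_QP\<close>. Since
      \<open>S A_QQ = A_PQ\<close>, subtracting the correction completes the \<open>P\<close> by
      \<open>P\<close> block of \<open>A N\<close>.\<close>
    have "(\<Sum>k\<in>P. (\<Sum>l\<in>Q. S i l * A l k) * N k j) = (\<Sum>l\<in>Q. S i l * (\<Sum>k\<in>P. A l k * N k j))"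
      unfolding sum_distrib_left sum_distrib_right by (subst sum.swap) (simp add: mult.assoc)
    also have "\<dots> = (\<Sum>l\<in>Q. S i l * - (\<Sum>m\<in>Q. A l m * N m j))"
    proof (intro sum.cong refl)
      fix l assume "l \<in> Q"
      then have "l \<noteq> j" using ij disj by blast
      with \<open>l \<in> Q\<close> have "(\<Sum>k\<in>P. A l k * N k j) = - (\<Sum>m\<in>Q. A l m * N m j)"
        using AN[of l j] ij by auto
      then show "S i l * (\<Sum>k\<in>P. A l k * N k j) = S i l * - (\<Sum>m\<in>Q. A l m * N m j)" by simp
    qed
    also have "\<dots> = - (\<Sum>m\<in>Q. (\<Sum>l\<in>Q. S i l * A l m) * N m j)"
      unfolding sum_distrib_left sum_distrib_right mult_minus_right sum_negf
      by (subst sum.swap) (simp add: mult.assoc)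
    also have "\<dots> = - (\<Sum>m\<in>Q. A i m * N m j)" by (simp add: SA)
    finally show "(\<Sum>k\<in>P. (A i k - (\<Sum>l\<in>Q. S i l * A l k)) * N k j) = of_bool (i = j)"
      using AN[of i j] ij by (simp add: left_diff_distrib sum_subtractf)
    \<comment> \<open>In the other order, \<open>N_PP S = - N_PQ\<close> completes the
      \<open>P\<close> by \<open>P\<close> block of \<open>N A\<close>.\<close>
    have "(\<Sum>k\<in>P. N i k * (\<Sum>l\<in>Q. S k l * A l j)) = (\<Sum>l\<in>Q. (\<Sum>k\<in>P. N i k * S k l) * A l j)"
      unfolding sum_distrib_left sum_distrib_right by (subst sum.swap) (simp add: mult.assoc)
    also have "\<dots> = - (\<Sum>l\<in>Q. N i l * A l j)"
      using ij by (simp add: NS sum_negf)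
    finally show "(\<Sum>k\<in>P. N i k * (A k j - (\<Sum>l\<in>Q. S k l * A l j))) = of_bool (i = j)"
      using NA[of i j] ij by (simp add: right_diff_distrib sum_subtractf)
  qed
qed

text \<open>\<open>Hmat\<close> is the Schur complement of \<open>Mmat\<close> on the observable
  agents, so its inverse is the block \<open>N_OO\<close> of the Neumann series \<open>N\<close>,
  and \<open>H^-1 S_OL = - N_OL\<close>. Hence \<open>v_O = N_OO a_O + N_OL a_L\<close>, a sum of
  nonnegative terms.\<close>

lemma Hinv_vO_lower_bounds:
  assumes model: "advertising_model \<zeta> abar zlo zhi pbar n D" and "0 < \<zeta>"
  shows "\<And>i j. i \<in> obs D \<Longrightarrow> j \<in> obs D \<Longrightarrow> of_bool (i = j) \<le> Hinv D i j"
    and "\<And>i. i \<in> obs D \<Longrightarrow> 0 \<le> vO D i"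
proof -
  have fin: "finite (agents D)" and fino: "finite (obs D)" and finl: "finite (lat D)"
    and disj: "obs D \<inter> lat D = {}"
    and G: "\<And>i j. i \<in> agents D \<Longrightarrow> j \<in> agents D \<Longrightarrow> 0 \<le> weight D i j"
    and row: "\<And>i. i \<in> agents D \<Longrightarrow> (\<Sum>j\<in>agents D. weight D i j) \<le> 1 - \<zeta>"
    and base: "\<And>i. i \<in> agents D \<Longrightarrow> 0 \<le> base D i"
    using model unfolding advertising_model_def agents_def by (auto simp: algebra_simps)
  have "1 - \<zeta> < 1" using \<open>0 < \<zeta>\<close> by simp
  have sub: "lat D \<subseteq> agents D" "obs D \<subseteq> agents D" by (auto simp: agents_def)
  obtain N where N0: "is_minv (agents D) (\<lambda>i j. of_bool (i = j) - weight D i j) N"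
    and N_ge: "\<And>i j. i \<in> agents D \<Longrightarrow> j \<in> agents D \<Longrightarrow> of_bool (i = j) \<le> N i j"
    using neumann_inverse[where I = "agents D" and A = "weight D" and r = "1 - \<zeta>", OF fin G row \<open>1 - \<zeta> < 1\<close>] by blast
  have N: "is_minv (obs D \<union> lat D) (Mmat D) N"
    using N0 unfolding agents_def Mmat_def by blast
  \<comment> \<open>The latent block inherits nonnegativity and the row sum bound, so it is
    invertible and the \<open>minv\<close> inside \<open>S_OL\<close> is a genuine inverse.\<close>
  have Gl: "0 \<le> weight D i j" if "i \<in> lat D" "j \<in> lat D" for i j
    using G that sub by blast
  have rowl: "(\<Sum>j\<in>lat D. weight D i j) \<le> 1 - \<zeta>" if "i \<in> lat D" for i
    using sum_mono2[OF fin sub(1), of "weight D i"] row[of i] G[of i] that sub by force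
  obtain B where "is_minv (lat D) (\<lambda>i j. of_bool (i = j) - weight D i j) B"
    using neumann_inverse[where I = "lat D" and A = "weight D" and r = "1 - \<zeta>",
        OF finl Gl rowl \<open>1 - \<zeta> < 1\<close>] by blast
  then have "is_minv (lat D) (Mmat D) B" unfolding Mmat_def .
  note B = minv_is_minv[OF this]
  \<comment> \<open>Unfolding \<open>S_OL_def\<close> reduces the premise on \<open>S\<close> to
    reflexivity; folding then restores \<open>S_OL\<close>.\<close>
  note schur = schur_complement_inverse[OF fino finl disj N B, of "S_OL D", unfolded S_OL_def, OF refl,
      folded S_OL_def]
  have Hinv: "Hinv D i j = N i j" if "i \<in> obs D" "j \<in> obs D" for i j
    unfolding Hinv_def
    by (rule minv_eq[OF fino _ that]) (use schur(1) in \<open>simp add: Hmat_def[abs_def]\<close>)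
  show "of_bool (i = j) \<le> Hinv D i j" if "i \<in> obs D" "j \<in> obs D" for i j
    using Hinv[OF that] N_ge[of i j] that by (simp add: agents_def)
  show "0 \<le> vO D i" if i: "i \<in> obs D" for i
  proof -
    have N_nonneg: "0 \<le> N i j" if "j \<in> agents D" for j
      using order_trans[OF zero_less_eq_of_bool N_ge[of i j]] that i by (simp add: agents_def)
    have "(\<Sum>j\<in>obs D. Hinv D i j * (\<Sum>l\<in>lat D. S_OL D j l * base D l))
        = (\<Sum>j\<in>obs D. N i j * (\<Sum>l\<in>lat D. S_OL D j l * base D l))"
      using i Hinv by simp
    also have "\<dots> = (\<Sum>l\<in>lat D. (\<Sum>j\<in>obs D. N i j * S_OL D j l) * base D l)"
      unfolding sum_distrib_left sum_distrib_right by (subst sum.swap) (simp add: mult.assoc)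
    also have "\<dots> = - (\<Sum>l\<in>lat D. N i l * base D l)"
      using i schur(2) by (simp add: sum_negf)
    finally have "vO D i = (\<Sum>j\<in>obs D. N i j * base D j) + (\<Sum>l\<in>lat D. N i l * base D l)"
      unfolding vO_def reduce_def using i Hinv by simp
    also have "\<dots> \<ge> 0"
      using sub by (intro add_nonneg_nonneg sum_nonneg mult_nonneg_nonneg N_nonneg base) auto
    finally show ?thesis .
  qed
qed

section \<open>Payoff and regret\<close>

text \<open>The zero of the gradient of \<open>payoff\<close>, without regard to the box constraint.
  \<open>p_hat\<close> is the same expression with an estimate in place of \<open>Htinv\<close>,
  clipped to the box.\<close>

definition unconstrained_opt :: "real \<Rightarrow> ('v, 'w) ad_model \<Rightarrow> 'v \<Rightarrow> real" where
  "unconstrained_opt chi D j = - (1 / chi) * (\<Sum>i\<in>obs D. Htinv D i j)"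

text \<open>Completing the square: the coefficient of \<open>p j\<close> in the linear part is
  \<open>chi\<close> times the value of \<open>unconstrained_opt\<close> at
  \<open>j\<close>.\<close>

lemma payoff_square:
  assumes "0 < chi"
  shows "payoff chi D p = (\<Sum>i\<in>obs D. vO D i)
    + chi / 2 * (\<Sum>j\<in>obs D. (unconstrained_opt chi D j)\<^sup>2)
    - chi / 2 * (\<Sum>j\<in>obs D. (p j - unconstrained_opt chi D j)\<^sup>2)"
proof -
  have "(\<Sum>i\<in>obs D. \<Sum>j\<in>obs D. Htinv D i j * p j) = (\<Sum>j\<in>obs D. (\<Sum>i\<in>obs D. Htinv D i j) * p j)"
    by (subst sum.swap) (simp add: sum_distrib_right)
  also have "\<dots> = - (\<Sum>j\<in>obs D. chi * unconstrained_opt chi D j * p j)"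
    using assms by (simp add: unconstrained_opt_def sum_negf)
  finally show ?thesis
    unfolding payoff_def
    by (simp add: sum_subtractf sum.distrib sum_distrib_left power2_diff algebra_simps)
qed

text \<open>By separability, a single coordinate that differs from the unconstrained optimum could
  be improved on its own.\<close>

lemma interior_optimum_eq:
  assumes "0 < chi" and fin: "finite (obs D)" and opt: "optimal_intensities chi pbar D p"
    and int: "\<And>i. i \<in> obs D \<Longrightarrow> 0 < p i \<and> p i < pbar" and j: "j \<in> obs D"
  shows "p j = unconstrained_opt chi D j"
proof (rule ccontr)
  let ?q = "unconstrained_opt chi D"
  assume ne: "p j \<noteq> ?q j"
  \<comment> \<open>\<open>x\<close> is the projection of \<open>?q j\<close> onto
    \<open>[0, pbar]\<close>. It is either \<open>?q j\<close> itself or the endpoint facing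
    \<open>?q j\<close>; as \<open>p j\<close> is interior, it is strictly closer to
    \<open>?q j\<close> than \<open>p j\<close> in both cases.\<close>
  define x where "x = max 0 (min pbar (?q j))"
  have "\<bar>x - ?q j\<bar> < \<bar>p j - ?q j\<bar>" and x: "0 \<le> x" "x \<le> pbar"
    unfolding x_def using ne int[OF j] by (auto split: split_max split_min)
  then have less: "(x - ?q j)\<^sup>2 < (p j - ?q j)\<^sup>2" by (metis abs_le_square_iff not_le)
  have "(\<Sum>i\<in>obs D. ((p(j := x)) i - ?q i)\<^sup>2) < (\<Sum>i\<in>obs D. (p i - ?q i)\<^sup>2)"
    using fin j less by (intro sum_strict_mono_ex1) auto
  then have "payoff chi D p < payoff chi D (p(j := x))"
    using \<open>0 < chi\<close> by (simp add: payoff_square del: fun_upd_apply)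
  moreover have "\<forall>i\<in>obs D. 0 \<le> (p(j := x)) i \<and> (p(j := x)) i \<le> pbar"
    using int x by (auto intro: less_imp_le)
  ultimately show False
    using opt unfolding optimal_intensities_def is_arg_max_def by blast
qed

section \<open>Error of the thresholded estimator\<close>

text \<open>If the entry is kept, the error is at most half of \<open>\<mu>\<close>, while the true
  entry exceeds \<open>\<mu>\<close> minus that half in absolute value. If it is set to zero, the
  error is the true entry itself, at most \<open>\<mu>\<close> plus half of
  \<open>\<mu>\<close>.\<close>

lemma threshold_error:
  assumes "2 * \<bar>W k j - T k j\<bar> \<le> \<mu> k j"
  shows "\<bar>threshold \<mu> W k j - T k j\<bar> \<le> 3 / 2 * \<mu> k j"
    and "\<bar>threshold \<mu> W k j - T k j\<bar> \<le> \<bar>T k j\<bar>"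
proof -
  have "threshold \<mu> W k j = W k j \<and> \<mu> k j < \<bar>W k j\<bar> \<or> threshold \<mu> W k j = 0 \<and> \<bar>W k j\<bar> \<le> \<mu> k j"
    by (auto simp: threshold_def)
  then show "\<bar>threshold \<mu> W k j - T k j\<bar> \<le> 3 / 2 * \<mu> k j"
    and "\<bar>threshold \<mu> W k j - T k j\<bar> \<le> \<bar>T k j\<bar>"
    using assms by argo+
qed

text \<open>Columns matter because \<open>p_hat\<close> depends on the estimate through its column
  sums. The column is split along the support \<open>K\<close> of the sparse approximation, which
  has at most \<open>s\<close> entries.\<close>

lemma threshold_column_error:
  assumes fin: "finite (obs D)" and sparse: "sparse_approx (obs D) (Hinv D) s r"
    and j: "j \<in> obs D" and eff: "0 \<le> eff D j" "eff D j \<le> z" and "0 \<le> m"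
    and W: "\<And>k. k \<in> obs D \<Longrightarrow> 2 * \<bar>W k j - Htinv D k j\<bar> \<le> \<mu> k j \<and> \<mu> k j \<le> m"
  shows "(\<Sum>k\<in>obs D. \<bar>threshold \<mu> W k j - Htinv D k j\<bar>) \<le> 3 / 2 * m * real s + z * r"
proof -
  let ?\<Delta> = "\<lambda>k. \<bar>threshold \<mu> W k j - Htinv D k j\<bar>"
  obtain A where A: "sparse_mat (obs D) s A"
    and "max (norm_col (obs D) (\<lambda>i j. Hinv D i j - A i j))
           (norm_row (obs D) (\<lambda>i j. Hinv D i j - A i j)) \<le> r"
    using sparse unfolding sparse_approx_def by blast
  then have "norm_col (obs D) (\<lambda>i j. Hinv D i j - A i j) \<le> r" by simp
  moreover have "(\<Sum>i\<in>obs D. \<bar>Hinv D i j - A i j\<bar>) \<le> norm_col (obs D) (\<lambda>i j. Hinv D i j - A i j)"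
    unfolding norm_col_def using fin j by (intro Max_ge) auto
  ultimately have col: "(\<Sum>i\<in>obs D. \<bar>Hinv D i j - A i j\<bar>) \<le> r" by linarith
  define K where "K = {k\<in>obs D. A k j \<noteq> 0}"
  have K: "K \<subseteq> obs D" "card K \<le> s" using A j unfolding K_def sparse_mat_def by auto
  have "(\<Sum>k\<in>K. ?\<Delta> k) \<le> (\<Sum>k\<in>K. 3 / 2 * m)"
  proof (rule sum_mono)
    fix k assume "k \<in> K"
    then show "?\<Delta> k \<le> 3 / 2 * m"
      using threshold_error(1)[of W k j "Htinv D" \<mu>] W[of k] K(1) by auto
  qed
  also have "\<dots> \<le> 3 / 2 * m * real s"
    using mult_right_mono[of "real (card K)" "real s" "3 / 2 * m"] K(2) \<open>0 \<le> m\<close>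
    by (simp add: mult.commute)
  finally have on: "(\<Sum>k\<in>K. ?\<Delta> k) \<le> 3 / 2 * m * real s" .
  have "(\<Sum>k\<in>obs D - K. ?\<Delta> k) \<le> (\<Sum>k\<in>obs D - K. z * \<bar>Hinv D k j - A k j\<bar>)"
  proof (rule sum_mono)
    fix k assume k: "k \<in> obs D - K"
    have "?\<Delta> k \<le> \<bar>Htinv D k j\<bar>"
      using threshold_error(2)[of W k j "Htinv D" \<mu>] W[of k] k by auto
    \<comment> \<open>Off \<open>K\<close> the approximation \<open>A\<close> vanishes, so
      subtracting it changes nothing and the column norm bound becomes applicable.\<close>
    also have "\<dots> = eff D j * \<bar>Hinv D k j - A k j\<bar>"
      using k eff unfolding Htinv_def K_def by (simp add: abs_mult)
    also have "\<dots> \<le> z * \<bar>Hinv D k j - A k j\<bar>" using eff by (intro mult_right_mono) auto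
    finally show "?\<Delta> k \<le> z * \<bar>Hinv D k j - A k j\<bar>" .
  qed
  also have "\<dots> \<le> (\<Sum>k\<in>obs D. z * \<bar>Hinv D k j - A k j\<bar>)"
    using fin eff by (intro sum_mono2) auto
  also have "\<dots> \<le> z * r"
    using col eff unfolding sum_distrib_left[symmetric] by (intro mult_left_mono) auto
  finally have off: "(\<Sum>k\<in>obs D - K. ?\<Delta> k) \<le> z * r" .
  show ?thesis using on off sum.subset_diff[OF K(1) fin, of ?\<Delta>] by simp
qed

section \<open>Regret in terms of the column error\<close>

text \<open>Both the payoff loss and the optimal payoff scale with \<open>chi / 2\<close> times the
  number of observable agents, so this factor cancels and the bound is free of the network
  size.\<close>

lemma regret_p_hat_le:
  assumes "0 < chi" and "0 < zlo" and "0 < \<zeta>"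
    and model: "advertising_model \<zeta> abar zlo zhi pbar n D"
    and opt: "optimal_intensities chi pbar D pstar"
    and int: "\<And>i. i \<in> obs D \<Longrightarrow> 0 < pstar i \<and> pstar i < pbar"
    and E: "\<And>j. j \<in> obs D \<Longrightarrow> (\<Sum>k\<in>obs D. \<bar>W k j - Htinv D k j\<bar>) \<le> E"
  shows "regret chi D pstar (p_hat chi pbar D W) \<le> (E / zlo)\<^sup>2"
proof (cases "obs D = {}")
  \<comment> \<open>Without observable agents both payoffs are \<open>0\<close>, and
    \<open>0 / 0 = 0\<close>.\<close>
  case True
  then show ?thesis by (simp add: regret_def payoff_def)
next
  case False
  let ?q = "unconstrained_opt chi D" and ?p = "p_hat chi pbar D W"
  have fin: "finite (obs D)" and eff: "\<And>i. i \<in> obs D \<Longrightarrow> zlo \<le> eff D i"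
    using model unfolding advertising_model_def agents_def by auto
  note H = Hinv_vO_lower_bounds(1)[OF model \<open>0 < \<zeta>\<close>] and v = Hinv_vO_lower_bounds(2)[OF model \<open>0 < \<zeta>\<close>]
  have pstar: "pstar j = ?q j" if "j \<in> obs D" for j
    using interior_optimum_eq[OF \<open>0 < chi\<close> fin opt int that] .
  \<comment> \<open>Each column sum of \<open>Hinv\<close> is at least its diagonal entry, hence at
    least 1.\<close>
  have q_ge: "zlo / chi \<le> ?q j" if j: "j \<in> obs D" for j
  proof -
    have "1 = (\<Sum>i\<in>obs D. of_bool (i = j) :: real)" using fin j by (simp add: of_bool_def)
    also have "\<dots> \<le> (\<Sum>i\<in>obs D. Hinv D i j)" using H j by (intro sum_mono) auto
    finally have "zlo * 1 \<le> eff D j * (\<Sum>i\<in>obs D. Hinv D i j)"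
      using eff[OF j] \<open>0 < zlo\<close> by (intro mult_mono) auto
    also have "\<dots> = chi * ?q j"
      using \<open>0 < chi\<close> by (simp add: unconstrained_opt_def Htinv_def sum_negf sum_distrib_left mult.commute)
    finally show ?thesis using \<open>0 < chi\<close> by (simp add: field_simps)
  qed
  have dist: "\<bar>?p j - ?q j\<bar> \<le> E / chi" if j: "j \<in> obs D" for j
  proof -
    define x where "x = - (1 / chi) * (\<Sum>k\<in>obs D. W k j)"
    \<comment> \<open>Clipping to \<open>[0, pbar]\<close> is nonexpansive and fixes
      \<open>?q j\<close>, which equals the interior \<open>pstar j\<close>.\<close>
    have "\<bar>?p j - ?q j\<bar> \<le> \<bar>x - ?q j\<bar>"
      using int[OF j] pstar[OF j] unfolding p_hat_def x_def[symmetric]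
      by (auto split: split_max split_min)
    also have "x - ?q j = - (1 / chi) * (\<Sum>k\<in>obs D. W k j - Htinv D k j)"
      unfolding x_def unconstrained_opt_def by (simp add: sum_subtractf right_diff_distrib)
    also have "\<bar>\<dots>\<bar> = (1 / chi) * \<bar>\<Sum>k\<in>obs D. W k j - Htinv D k j\<bar>"
      using \<open>0 < chi\<close> by (simp add: abs_mult)
    also have "\<dots> \<le> (1 / chi) * E"
      using \<open>0 < chi\<close> order_trans[OF sum_abs E[OF j]] by (intro mult_left_mono) auto
    finally show ?thesis by simp
  qed
  let ?N = "real (card (obs D))"
  have "0 < ?N" using False fin by (simp add: card_gt_0_iff)
  have best: "payoff chi D pstar = (\<Sum>i\<in>obs D. vO D i) + chi / 2 * (\<Sum>j\<in>obs D. (?q j)\<^sup>2)"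
    using pstar by (simp add: payoff_square[OF \<open>0 < chi\<close>])
  have "?N * (zlo / chi)\<^sup>2 \<le> (\<Sum>j\<in>obs D. (?q j)\<^sup>2)"
    using q_ge \<open>0 < chi\<close> \<open>0 < zlo\<close> by (intro sum_bounded_below power_mono) auto
  then have low: "chi / 2 * (?N * (zlo / chi)\<^sup>2) \<le> payoff chi D pstar"
    unfolding best using \<open>0 < chi\<close> sum_nonneg[of "obs D" "vO D", OF v]
    by (intro order_trans[OF mult_left_mono add_increasing[OF _ order_refl]]) auto
  have "(?p j - ?q j)\<^sup>2 \<le> (E / chi)\<^sup>2" if "j \<in> obs D" for j
    using dist[OF that] by (rule abs_le_square_iff[THEN iffD1, OF order_trans[OF _ abs_ge_self]])
  then have "(\<Sum>j\<in>obs D. (?p j - ?q j)\<^sup>2) \<le> ?N * (E / chi)\<^sup>2"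
    by (rule sum_bounded_above)
  then have up: "payoff chi D pstar - payoff chi D ?p \<le> chi / 2 * (?N * (E / chi)\<^sup>2)"
    unfolding best payoff_square[OF \<open>0 < chi\<close>, of D ?p] using \<open>0 < chi\<close> by simp
  have pos: "0 < chi / 2 * (?N * (zlo / chi)\<^sup>2)" using \<open>0 < ?N\<close> \<open>0 < chi\<close> \<open>0 < zlo\<close> by simp
  have "regret chi D pstar ?p \<le> (chi / 2 * (?N * (E / chi)\<^sup>2)) / (chi / 2 * (?N * (zlo / chi)\<^sup>2))"
    unfolding regret_def using up low pos \<open>0 < chi\<close> by (intro frac_le) auto
  also have "\<dots> = (E / zlo)\<^sup>2"
    using \<open>0 < ?N\<close> \<open>0 < chi\<close> \<open>0 < zlo\<close> by (simp add: power_divide)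
  finally show ?thesis .
qed

section \<open>From deterministic bounds to high probability\<close>

text \<open>The measurable sets that witness \<open>P\<close> also witness \<open>Q\<close>, so
  \<open>Q\<close> itself may be nonmeasurable.\<close>

lemma whp_mono:
  assumes "whp M P" and "\<And>n \<omega>. n \<ge> 1 \<Longrightarrow> P n \<omega> \<Longrightarrow> Q n \<omega>"
  shows "whp M Q"
proof -
  obtain A where A: "\<And>n. A n \<in> sets (M n)" "\<And>n \<omega>. \<omega> \<in> A n \<Longrightarrow> P n \<omega>"
    "(\<lambda>n. measure (M n) (A n)) \<longlonglongrightarrow> 1"
    using assms(1) unfolding whp_def by blast
  \<comment> \<open>The implication is given only for positive \<open>n\<close>; the empty set
    serves at \<open>n = 0\<close> and leaves the limit unchanged.\<close>
  define A' where "A' n = (if n = 0 then {} else A n)" for n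
  have "(\<lambda>n. measure (M n) (A' n)) \<longlonglongrightarrow> 1"
    using eventually_gt_at_top[of 0]
    by (rule Lim_transform_eventually[OF A(3), rotated, OF eventually_mono]) (simp add: A'_def)
  then show ?thesis
    unfolding whp_def using A assms(2) by (intro exI[of _ A']) (auto simp: A'_def)
qed

lemma power2_sum_le: "(a + b)\<^sup>2 \<le> 2 * a\<^sup>2 + 2 * (b::real)\<^sup>2"
  using zero_le_power2[of "a - b"] unfolding power2_sum power2_diff by linarith

theorem theorem3:
  fixes D :: "nat \<Rightarrow> ('v, 'w) ad_model"
    and s :: "nat \<Rightarrow> nat" and r1 :: "nat \<Rightarrow> real"
    and chi pbar abar zlo zhi \<zeta> C0 :: real
    and pstar :: "nat \<Rightarrow> 'v \<Rightarrow> real"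
    and What :: "nat \<Rightarrow> 'w \<Rightarrow> 'v \<Rightarrow> 'v \<Rightarrow> real"
    and vhat zhat :: "nat \<Rightarrow> 'w \<Rightarrow> 'v \<Rightarrow> real"
    and Psihat :: "nat \<Rightarrow> 'w \<Rightarrow> 'v option \<Rightarrow> 'v option \<Rightarrow> real"
    and \<mu> :: "nat \<Rightarrow> 'w \<Rightarrow> 'v \<Rightarrow> 'v \<Rightarrow> real"
  assumes "0 < chi" and "0 < zlo" and "0 < \<zeta>"
    and "\<And>n. n \<ge> 1 \<Longrightarrow> advertising_model \<zeta> abar zlo zhi pbar n (D n)"
    and "\<And>n. n \<ge> 1 \<Longrightarrow> sparse_approx (obs (D n)) (Hinv (D n)) (s n) (r1 n)"
    and "regular_design s D"
    and "\<And>n. n \<ge> 1 \<Longrightarrow> optimal_intensities chi pbar (D n) (pstar n)"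
    and "\<And>n i. n \<ge> 1 \<Longrightarrow> i \<in> obs (D n) \<Longrightarrow> 0 < pstar n i \<and> pstar n i < pbar"
    and "(\<lambda>n. real (s n) * sqrt (ln (real (card (obs (D n)))) / real n) + r1 n) \<in> o(\<lambda>_. 1)"
    and "\<And>n \<omega>. n \<ge> 1 \<Longrightarrow> \<omega> \<in> space (Pr (D n)) \<Longrightarrow>
           step1_solution n (D n) \<omega> (What n \<omega>) (vhat n \<omega>) (zhat n \<omega>)"
    and "\<And>n \<omega>. n \<ge> 1 \<Longrightarrow> \<omega> \<in> space (Pr (D n)) \<Longrightarrow>
           step2_solution n (D n) \<omega> (Psihat n \<omega>)"
    and "0 < C0"
    and "whp (\<lambda>n. Pr (D n)) (\<lambda>n \<omega>. \<forall>k\<in>obs (D n). \<forall>j\<in>obs (D n).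
           2 * \<bar>W_check n (D n) \<omega> (What n \<omega>) (vhat n \<omega>) (Psihat n \<omega>) k j - Htinv (D n) k j\<bar>
             \<le> \<mu> n \<omega> k j \<and>
           \<mu> n \<omega> k j \<le> C0 * sqrt (ln (real (card (obs (D n)))) / real n))"
  shows "\<exists>C1>0. whp (\<lambda>n. Pr (D n)) (\<lambda>n \<omega>.
           regret chi (D n) (pstar n)
             (p_hat chi pbar (D n) (threshold (\<mu> n \<omega>)
                (W_check n (D n) \<omega> (What n \<omega>) (vhat n \<omega>) (Psihat n \<omega>))))
           \<le> C1 * ((real (s n))\<^sup>2 * (ln (real (card (obs (D n)))) / real n) + (r1 n)\<^sup>2))"
proof (intro exI conjI)
  let ?x = "\<lambda>n. ln (real (card (obs (D n)))) / real n"
  \<comment> \<open>The constant results from \<open>(E / zlo)^2\<close> and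
    \<open>(a + b)^2 \<le> 2 a^2 + 2 b^2\<close>, where \<open>a\<close> is the thresholding part of
    \<open>E\<close> with factor \<open>3/2 C0\<close>, and \<open>b\<close> is the approximation
    part with factor \<open>zhi\<close>.\<close>
  define C1 where "C1 = 2 * (9 / 4 * C0\<^sup>2 + zhi\<^sup>2) / zlo\<^sup>2"
  show "0 < C1" unfolding C1_def using \<open>0 < C0\<close> \<open>0 < zlo\<close> by (simp add: add_pos_nonneg)
  show "whp (\<lambda>n. Pr (D n)) (\<lambda>n \<omega>.
      regret chi (D n) (pstar n)
        (p_hat chi pbar (D n) (threshold (\<mu> n \<omega>)
           (W_check n (D n) \<omega> (What n \<omega>) (vhat n \<omega>) (Psihat n \<omega>))))
      \<le> C1 * ((real (s n))\<^sup>2 * ?x n + (r1 n)\<^sup>2))"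
  \<comment> \<open>From here on \<open>n\<close> and \<open>\<omega>\<close> are fixed, and the
    argument on the good event is deterministic.\<close>
  proof (rule whp_mono[OF assms(13)], goal_cases)
    case (1 n \<omega>)
    let ?W = "W_check n (D n) \<omega> (What n \<omega>) (vhat n \<omega>) (Psihat n \<omega>)"
    define E where "E = 3 / 2 * (C0 * sqrt (?x n)) * real (s n) + zhi * r1 n"
    note model = assms(4)[OF \<open>n \<ge> 1\<close>]
    have fin: "finite (obs (D n))"
      and eff: "zlo \<le> eff (D n) i" "eff (D n) i < zhi" if "i \<in> obs (D n)" for i
      using model that unfolding advertising_model_def agents_def by auto
    have x: "0 \<le> ?x n"
      \<comment> \<open>\<open>ln 0 = 0\<close> covers the case of no observable agents\<close>
      by (cases "card (obs (D n)) = 0") auto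
    have "(\<Sum>k\<in>obs (D n). \<bar>threshold (\<mu> n \<omega>) ?W k j - Htinv (D n) k j\<bar>) \<le> E"
      if j: "j \<in> obs (D n)" for j
      unfolding E_def
      using 1 eff[OF j] x \<open>0 < zlo\<close> \<open>0 < C0\<close> j
      by (intro threshold_column_error[OF fin[OF j] assms(5)]) auto
    then have "regret chi (D n) (pstar n) (p_hat chi pbar (D n) (threshold (\<mu> n \<omega>) ?W))
        \<le> (E / zlo)\<^sup>2"
      using regret_p_hat_le[OF assms(1-3) model assms(7) assms(8)] \<open>n \<ge> 1\<close> by blast
    also have "(E / zlo)\<^sup>2
        \<le> (2 * (3 / 2 * (C0 * sqrt (?x n)) * real (s n))\<^sup>2 + 2 * (zhi * r1 n)\<^sup>2) / zlo\<^sup>2"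
      unfolding E_def power_divide by (intro divide_right_mono power2_sum_le) simp
    also have "\<dots> = 2 * (9 / 4 * C0\<^sup>2 * ((real (s n))\<^sup>2 * ?x n) + zhi\<^sup>2 * (r1 n)\<^sup>2) / zlo\<^sup>2"
      unfolding power_mult_distrib real_sqrt_pow2[OF x] by (simp add: power_divide)
    also have "\<dots> \<le> C1 * ((real (s n))\<^sup>2 * ?x n + (r1 n)\<^sup>2)"
    proof -
      \<comment> \<open>These are the two cross terms that appear when the product of the two sums
        is expanded.\<close>
      have cross: "0 \<le> 9 / 4 * C0\<^sup>2 * (r1 n)\<^sup>2" "0 \<le> zhi\<^sup>2 * ((real (s n))\<^sup>2 * ?x n)"
        using x by (intro mult_nonneg_nonneg; simp)+
      have "9 / 4 * C0\<^sup>2 * ((real (s n))\<^sup>2 * ?x n) + zhi\<^sup>2 * (r1 n)\<^sup>2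
          \<le> (9 / 4 * C0\<^sup>2 + zhi\<^sup>2) * ((real (s n))\<^sup>2 * ?x n + (r1 n)\<^sup>2)"
        unfolding distrib_left distrib_right using cross by linarith
      from divide_right_mono[OF mult_left_mono[OF this, of 2], of "zlo\<^sup>2"]
      show ?thesis unfolding C1_def by (simp only: mult.assoc times_divide_eq_left) simp
    qed
    finally show ?case .
  qed
qed

end
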